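(* There exists a planar graph $G_2$ such that for every star forest $F$ in $G_2$ (a subgraph of $G_2$ each of whose components is a star), the graph $G_2-E(F)$ contains $K_4$ as a subgraph (and hence is not $3$-colourable). *)

theory Defs
  imports "HOL-Analysis.Analysis"
begin

definition simple_graph :: "'a set \<Rightarrow> 'a set set \<Rightarrow> bool" where
  "simple_graph V E \<longleftrightarrow> finite V \<and>
     (\<forall>e\<in>E. \<exists>u v. u \<in> V \<and> v \<in> V \<and> u \<noteq> v \<and> e = {u, v})"

definition planar_graph :: "'a set \<Rightarrow> 'a set set \<Rightarrow> bool" where
  "planar_graph V E \<longleftrightarrow> simple_graph V E \<and>
     (\<exists>(pos :: 'a \<Rightarrow> complex) (arcs :: 'a set \<Rightarrow> real \<Rightarrow> complex).
        inj_on pos V \<and>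
        (\<forall>e\<in>E. arc (arcs e) \<and>
           (\<exists>u v. e = {u, v} \<and> pathstart (arcs e) = pos u \<and> pathfinish (arcs e) = pos v) \<and>
           path_image (arcs e) \<inter> pos ` V = pos ` e) \<and>
        (\<forall>e\<in>E. \<forall>e'\<in>E. e \<noteq> e' \<longrightarrow>
           path_image (arcs e) \<inter> path_image (arcs e') \<subseteq> pos ` (e \<inter> e')))"

definition connected_in :: "'a set set \<Rightarrow> 'a \<Rightarrow> 'a \<Rightarrow> bool" where
  "connected_in F u v \<longleftrightarrow> (u, v) \<in> {(x, y). {x, y} \<in> F}\<^sup>*"

definition is_star :: "'a set \<Rightarrow> 'a set set \<Rightarrow> bool" where
  "is_star C S \<longleftrightarrow> (\<exists>c\<in>C. S = {{c, w} | w. w \<in> C \<and> w \<noteq> c})"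

text \<open>A star forest in G = (V, E): a subgraph (taken spanning, which is harmless since
  isolated vertices are trivial stars) each of whose components is a star.\<close>
definition star_forest :: "'a set \<Rightarrow> 'a set set \<Rightarrow> 'a set set \<Rightarrow> bool" where
  "star_forest V E F \<longleftrightarrow> F \<subseteq> E \<and>
     (\<forall>u\<in>V. is_star {v \<in> V. connected_in F u v} {e \<in> F. e \<subseteq> {v \<in> V. connected_in F u v}})"

definition contains_K4 :: "'a set \<Rightarrow> 'a set set \<Rightarrow> bool" where
  "contains_K4 V E \<longleftrightarrow> (\<exists>K \<subseteq> V. card K = 4 \<and>
     (\<forall>x\<in>K. \<forall>y\<in>K. x \<noteq> y \<longrightarrow> {x, y} \<in> E))"

end

theory Submission
  imports Defs
begin

text \<open>
  The graph is a stacked triangulation: start with a triangle and repeatedly, 13 times, put a new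
  vertex into every bounded face and join it to the three corners. Placing new vertices at
  centroids gives a straight-line drawing.

  Let F be a star forest meeting every K4. Every edge of F has an end of degree one in F, so after
  at most two stackings some face has no edge in F. Stack a vertex m into such a face T; as T and m
  form a K4, some corner of T is F-adjacent to m. If two corners are, they are leaves with centre m,
  and pushing the third corner of the face they span with m inwards yields a face whose corners are
  leaves with centres outside; a vertex stacked there gives a K4 avoiding F. If only the corner x is,
  replacing x by m gives another face without edges in F. Give a corner weight 0 if all its
  F-neighbours lie among the vertices present so far, 1 if all its other F-neighbours are leaves,
  and 2 otherwise. Having a neighbour outside, m has weight at most 1, and weight 0 if x had
  weight 1, so the total weight of the face drops. Hence after at most six steps all corners have
  weight 0, and stacking once more gives a K4 avoiding F.
\<close>

section \<open>Star forests\<close>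

text \<open>The component of \<open>x\<close> is a star, so each of its edges contains the centre
  \<open>c\<close>. The end of \<open>{x, y}\<close> other than \<open>c\<close> thus has only
  \<open>c\<close> as neighbour. The locale \<open>leaf_forest\<close> keeps just this
  consequence.\<close>

lemma star_forest_leaf:
  assumes G: "simple_graph V E" and F: "star_forest V E F" and xy: "{x, y} \<in> F"
  shows "(\<forall>z. {x, z} \<in> F \<longrightarrow> z = y) \<or> (\<forall>z. {y, z} \<in> F \<longrightarrow> z = x)"
proof -
  have inV: "u \<in> V \<and> v \<in> V \<and> u \<noteq> v" if "{u, v} \<in> F" for u v
  proof -
    have "{u, v} \<in> E" using that F by (auto simp: star_forest_def)
    then obtain u' v' where "u' \<in> V" "v' \<in> V" "u' \<noteq> v'" "{u, v} = {u', v'}"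
      using G by (auto simp: simple_graph_def)
    then show ?thesis by (auto simp: doubleton_eq_iff)
  qed
  define C where "C = {v \<in> V. connected_in F x v}"
  have "is_star C {e \<in> F. e \<subseteq> C}"
    using F inV[OF xy] by (auto simp: star_forest_def C_def)
  then obtain c where c: "{e \<in> F. e \<subseteq> C} = {{c, w} |w. w \<in> C \<and> w \<noteq> c}"
    by (auto simp: is_star_def)
  have xC: "x \<in> C" using inV[OF xy] by (auto simp: C_def connected_in_def)
  have step: "v \<in> C" if "u \<in> C" "{u, v} \<in> F" for u v
    using that inV[OF that(2)]
    by (auto simp: C_def connected_in_def intro: rtrancl_into_rtrancl)
  have star: "c = u \<or> c = v" if "u \<in> C" "{u, v} \<in> F" for u v
  proof -
    have "{u, v} \<in> {e \<in> F. e \<subseteq> C}" using that step by blast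
    then show ?thesis unfolding c by (auto simp: doubleton_eq_iff)
  qed
  have yC: "y \<in> C" using step xC xy by blast
  from star[OF xC xy] show ?thesis
  proof
    assume "c = x"
    then have "\<forall>z. {y, z} \<in> F \<longrightarrow> z = x" using star[OF yC] inV[OF xy] by auto
    then show ?thesis ..
  next
    assume "c = y"
    then have "\<forall>z. {x, z} \<in> F \<longrightarrow> z = y" using star[OF xC] inV[OF xy] by auto
    then show ?thesis ..
  qed
qed

section \<open>Iterated stacking into triangles\<close>

definition triangle_in :: "'a set \<Rightarrow> 'a set set \<Rightarrow> 'a set \<Rightarrow> bool" where
  "triangle_in V E T \<longleftrightarrow> T \<subseteq> V \<and> card T = 3 \<and> (\<forall>x\<in>T. \<forall>y\<in>T. x \<noteq> y \<longrightarrow> {x, y} \<in> E)"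

lemma triangle_inI:
  assumes "a \<noteq> b" "b \<noteq> c" "a \<noteq> c" "{a, b, c} \<subseteq> V" "{{a, b}, {b, c}, {c, a}} \<subseteq> E"
  shows "triangle_in V E {a, b, c}"
proof -
  have "{b, a} \<in> E" "{c, b} \<in> E" "{a, c} \<in> E" using assms(5) by (simp_all add: insert_commute)
  then show ?thesis using assms by (simp add: triangle_in_def)
qed

text \<open>The set A collects the vertices that are already present; the vertices stacked
  into T have to be new.\<close>
fun stacked :: "'a set \<Rightarrow> 'a set set \<Rightarrow> nat \<Rightarrow> 'a set \<Rightarrow> 'a set \<Rightarrow> bool" where
  "stacked V E 0 A T \<longleftrightarrow> T \<subseteq> A \<and> triangle_in V E T"
| "stacked V E (Suc n) A T \<longleftrightarrow> T \<subseteq> A \<and> triangle_in V E T \<and>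
     (\<exists>m\<in>V - A. \<forall>x\<in>T. stacked V E n (insert m A) (insert m (T - {x})))"

lemma stacked_triangle: "stacked V E n A T \<Longrightarrow> T \<subseteq> A \<and> triangle_in V E T"
  by (cases n) auto

declare stacked.simps [simp del]

lemma stacked_Suc_imp: "stacked V E (Suc n) A T \<Longrightarrow> stacked V E n A T"
proof (induction n arbitrary: A T)
  case 0
  then show ?case by (simp add: stacked.simps)
next
  case (Suc n)
  obtain m where m: "m \<in> V - A"
    "\<forall>x\<in>T. stacked V E (Suc n) (insert m A) (insert m (T - {x}))"
    using Suc.prems unfolding stacked.simps(2)[of V E "Suc n" A T] by blast
  then have "\<forall>x\<in>T. stacked V E n (insert m A) (insert m (T - {x}))"
    using Suc.IH by blast
  then show ?case using m(1) stacked_triangle[OF Suc.prems] unfolding stacked.simps(2) by blast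
qed

lemma stacked_mono: "stacked V E n A T \<Longrightarrow> k \<le> n \<Longrightarrow> stacked V E k A T"
  by (induction n) (auto simp: le_Suc_eq dest: stacked_Suc_imp)

lemma card_3_third:
  assumes "card T = 3" "x \<in> T" "y \<in> T" "x \<noteq> y"
  obtains z where "T = {x, y, z}" "z \<noteq> x" "z \<noteq> y"
  using assms by (fastforce simp: card_3_iff)

lemma stacked_SucE:
  assumes "stacked V E (Suc n) A T"
  obtains m where "m \<in> V" "m \<notin> A" "\<And>x. x \<in> T \<Longrightarrow> stacked V E n (insert m A) (insert m (T - {x}))"
    "\<And>x. x \<in> T \<Longrightarrow> {m, x} \<in> E"
proof -
  obtain m where m: "m \<in> V - A" "\<forall>x\<in>T. stacked V E n (insert m A) (insert m (T - {x}))"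
    using assms unfolding stacked.simps by blast
  have T: "T \<subseteq> A" "card T = 3" using stacked_triangle[OF assms] by (auto simp: triangle_in_def)
  have "{m, x} \<in> E" if "x \<in> T" for x
  proof -
    \<comment> \<open>The edge from \<open>m\<close> to \<open>x\<close> is read off a new face that
      keeps \<open>x\<close>, namely one that drops another corner \<open>y\<close>.\<close>
    obtain y where "y \<in> T" "y \<noteq> x"
      using T(2) that by (auto simp: card_3_iff)
    then have "triangle_in V E (insert m (T - {y}))" using m(2) stacked_triangle by blast
    then show ?thesis using that \<open>y \<noteq> x\<close> T(1) m(1) by (auto simp: triangle_in_def)
  qed
  then show ?thesis using that m by blast
qed

section \<open>Descent on the weight of a face without forest edges\<close>

locale leaf_forest =
  fixes V :: "'a set" and E F :: "'a set set"
  assumes leaf: "{x, y} \<in> F \<Longrightarrow> (\<forall>z. {x, z} \<in> F \<longrightarrow> z = y) \<or> (\<forall>z. {y, z} \<in> F \<longrightarrow> z = x)"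
    and no_K4: "\<not> contains_K4 V (E - F)"
begin

definition free :: "'a set \<Rightarrow> bool" where
  "free T \<longleftrightarrow> (\<forall>x\<in>T. \<forall>y\<in>T. x \<noteq> y \<longrightarrow> {x, y} \<notin> F)"

definition dead :: "'a set \<Rightarrow> 'a \<Rightarrow> bool" where
  "dead A x \<longleftrightarrow> (\<forall>y. {x, y} \<in> F \<longrightarrow> y \<in> A)"

text \<open>The \<open>F\<close>-neighbours of \<open>x\<close> outside \<open>A\<close> hang from
  \<open>x\<close> as leaves; for \<open>x\<close> in \<open>A\<close>, such a neighbour is dead as
  soon as it is added to \<open>A\<close>.\<close>

definition good :: "'a set \<Rightarrow> 'a \<Rightarrow> bool" where
  "good A x \<longleftrightarrow> (\<forall>y. {x, y} \<in> F \<longrightarrow> y \<notin> A \<longrightarrow> (\<forall>z. {y, z} \<in> F \<longrightarrow> z = x))"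

definition weight :: "'a set \<Rightarrow> 'a \<Rightarrow> nat" where
  "weight A x = (if dead A x then 0 else if good A x then 1 else 2)"

lemma weight_mono: "A \<subseteq> B \<Longrightarrow> weight B x \<le> weight A x"
  by (auto simp: weight_def dead_def good_def)

text \<open>If \<open>m\<close> has a neighbour \<open>y\<close> outside \<open>A\<close>, then
  \<open>m\<close> is not the leaf of \<open>{m, y}\<close>, having the neighbour \<open>x\<close>
  too; hence \<open>y\<close> is.\<close>

lemma good_if_neighbour:
  assumes "{m, x} \<in> F" "x \<in> A"
  shows "good A m"
  using assms leaf unfolding good_def by metis

text \<open>The stacked vertex \<open>m\<close> and the corners of \<open>T\<close> span a K4, which
  must meet \<open>F\<close>; as \<open>T\<close> is free, it does so in an edge at
  \<open>m\<close>. The other end of this edge is already present, whence \<open>m\<close> is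
  good.\<close>

lemma stacked_neighbour:
  assumes "stacked V E (Suc n) A T" "free T"
  obtains m x where "m \<in> V" "m \<notin> A" "x \<in> T" "{m, x} \<in> F" "good (insert m A) m"
    "\<And>x. x \<in> T \<Longrightarrow> stacked V E n (insert m A) (insert m (T - {x}))"
proof -
  from stacked_SucE[OF assms(1)] obtain m where m: "m \<in> V" "m \<notin> A"
    "\<And>x. x \<in> T \<Longrightarrow> stacked V E n (insert m A) (insert m (T - {x}))"
    "\<And>x. x \<in> T \<Longrightarrow> {m, x} \<in> E" by blast
  have T: "T \<subseteq> A" "triangle_in V E T" using stacked_triangle[OF assms(1)] by auto
  have "\<exists>x\<in>T. {m, x} \<in> F"
  proof (rule ccontr)
    assume no: "\<not> (\<exists>x\<in>T. {m, x} \<in> F)"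
    have "finite T" using T(2) by (auto simp: triangle_in_def intro: card_ge_0_finite)
    moreover have "m \<notin> T" using T m by blast
    ultimately have "card (insert m T) = 4" "insert m T \<subseteq> V"
      using T m by (auto simp: triangle_in_def)
    moreover have "{x, y} \<in> E - F" if "x \<in> insert m T" "y \<in> insert m T" "x \<noteq> y" for x y
    proof (cases "x = m \<or> y = m")
      case True
      then show ?thesis using that no m(4) by (auto simp: insert_commute[of _ m])
    next
      case False
      then show ?thesis using that T(2) assms(2) by (auto simp: triangle_in_def free_def)
    qed
    ultimately have "contains_K4 V (E - F)" unfolding contains_K4_def by metis
    then show False using no_K4 by blast
  qed
  then obtain x where "x \<in> T" "{m, x} \<in> F" by blast
  then show ?thesis using that m good_if_neighbour T by blast
qed

lemma freeI: "{a, b} \<notin> F \<Longrightarrow> {a, c} \<notin> F \<Longrightarrow> {b, c} \<notin> F \<Longrightarrow> free {a, b, c}"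
  by (simp add: free_def insert_commute[of b a] insert_commute[of c a] insert_commute[of c b])

lemma free_insert:
  assumes "free T" "\<And>y. y \<in> T \<Longrightarrow> {m, y} \<notin> F"
  shows "free (insert m T)"
  using assms by (auto simp: free_def insert_commute)

lemma free_subset: "free T \<Longrightarrow> S \<subseteq> T \<Longrightarrow> free S"
  by (auto simp: free_def)

text \<open>Two leaves whose centres lie outside can be kept while the third corner is pushed
  inwards: first to a vertex with a neighbour outside, then to a third such leaf.\<close>
lemma no_two_dead:
  assumes "stacked V E 4 A T" "x \<in> T" "y \<in> T" "x \<noteq> y" "{x, y} \<notin> F" "dead A x" "dead A y"
  shows False
proof -
  have far: "{w, x} \<notin> F" "{w, y} \<notin> F" if "w \<notin> A" for w
    using that assms(6,7) by (auto simp: dead_def insert_commute)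
  have free: "free {w, x, y}" if "w \<notin> A" for w
    using far[OF that] assms(5) by (auto simp: free_def insert_commute)
  \<comment> \<open>The face on \<open>z\<close>, \<open>x\<close>, \<open>y\<close> is free, so the
    vertex \<open>t\<close> stacked into it has an \<open>F\<close>-neighbour among them. This can
    only be \<open>z\<close>, and dropping \<open>z\<close> leads to the next face with corners
    \<open>x\<close> and \<open>y\<close>.\<close>
  have push: "\<exists>t. t \<notin> B \<and> {t, z} \<in> F \<and> stacked V E n (insert t B) {t, x, y}"
    if S: "stacked V E (Suc n) B {z, x, y}" and z: "z \<notin> A" and B: "A \<subseteq> B" for n B z
  proof -
    from stacked_neighbour[OF S free[OF z]] obtain t u where t: "t \<in> V" "t \<notin> B"
      "u \<in> {z, x, y}" "{t, u} \<in> F" "good (insert t B) t"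
      "\<And>v. v \<in> {z, x, y} \<Longrightarrow> stacked V E n (insert t B) (insert t ({z, x, y} - {v}))" by metis
    have "x \<in> A" "y \<in> A" using assms(1-3) stacked_triangle by blast+
    then have "{z, x, y} - {z} = {x, y}" using z by auto
    then have "stacked V E n (insert t B) {t, x, y}" using t(6)[of z] by simp
    moreover have "{t, z} \<in> F" using t(2,3,4) far[of t] B by auto
    ultimately show ?thesis using t by blast
  qed
  have "card T = 3" using stacked_triangle[OF assms(1)] by (simp add: triangle_in_def)
  from card_3_third[OF this assms(2-4)] obtain z where z: "T = {x, y, z}" "z \<noteq> x" "z \<noteq> y" .
  \<comment> \<open>The four levels are spent on the vertices \<open>w\<close>, \<open>t\<close>,
    \<open>s\<close> and \<open>r\<close>, in this order.\<close>
  have "stacked V E (Suc 3) A T" using assms(1) by (simp add: eval_nat_numeral)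
  from stacked_SucE[OF this] obtain w where w: "w \<notin> A"
    "stacked V E 3 (insert w A) (insert w (T - {z}))" using z by (metis insertI1 insertI2)
  have "insert w (T - {z}) = {w, x, y}" using z by auto
  then have "stacked V E (Suc 2) (insert w A) {w, x, y}" using w by (simp add: eval_nat_numeral)
  from push[OF this w(1)] obtain t where t: "t \<notin> insert w A" "{t, w} \<in> F"
    "stacked V E (Suc 1) (insert t (insert w A)) {t, x, y}" by (auto simp: eval_nat_numeral)
  from push[OF t(3)] t(1) obtain s where s: "s \<notin> insert t (insert w A)" "{s, t} \<in> F"
    "stacked V E (Suc 0) (insert s (insert t (insert w A))) {s, x, y}" by auto
  from push[OF s(3)] s(1) obtain r where r: "r \<notin> insert s (insert t (insert w A))" "{r, s} \<in> F"
    by auto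
  \<comment> \<open>On the path \<open>w\<close>, \<open>t\<close>, \<open>s\<close>,
    \<open>r\<close> in \<open>F\<close> both ends of the middle edge have a second neighbour, so
    neither is a leaf.\<close>
  show False using leaf[OF s(2)] r t s by (metis insert_commute insertI1 insertI2)
qed

text \<open>Induction on a bound for the total weight: a stacking either yields two dead corners or
  lowers the weight. The offset 5 leaves, once \<open>m\<close> is stacked, at least the four levels
  that \<open>no_two_dead\<close> consumes.\<close>

lemma no_free_triangle:
  assumes "stacked V E (k + 5) A T" "free T" "(\<Sum>x\<in>T. weight A x) \<le> k"
  shows False
  using assms
proof (induction k arbitrary: A T)
  case 0
  have T: "finite T" "T \<subseteq> A" using stacked_triangle[OF 0(1)] by (auto simp: triangle_in_def intro: card_ge_0_finite)
  have "stacked V E (Suc 4) A T" using 0(1) by simp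
  from stacked_neighbour[OF this 0(2)] obtain m x where "m \<notin> A" "x \<in> T" "{m, x} \<in> F"
    by metis
  moreover have "dead A x" using 0(3) T \<open>x \<in> T\<close> by (auto simp: weight_def split: if_splits)
  ultimately show False by (auto simp: dead_def insert_commute)
next
  case (Suc k)
  have T: "finite T" "T \<subseteq> A" using stacked_triangle[OF Suc.prems(1)]
    by (auto simp: triangle_in_def intro: card_ge_0_finite)
  have "stacked V E (Suc (k + 5)) A T" using Suc.prems(1) by (simp only: add_Suc)
  from stacked_neighbour[OF this Suc.prems(2)] obtain m x where m: "m \<notin> A" "x \<in> T" "{m, x} \<in> F"
    "good (insert m A) m" and sub:
    "\<And>x. x \<in> T \<Longrightarrow> stacked V E (k + 5) (insert m A) (insert m (T - {x}))" by metis
  show False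
  proof (cases "\<exists>y\<in>T. y \<noteq> x \<and> {m, y} \<in> F")
    case True
    then obtain y where y: "y \<in> T" "y \<noteq> x" "{m, y} \<in> F" by blast
    \<comment> \<open>Having two \<open>F\<close>-neighbours, \<open>m\<close> is a leaf of neither
      edge; so \<open>x\<close> and \<open>y\<close> are leaves whose sole neighbour
      \<open>m\<close> is now present.\<close>
    have "dead (insert m A) x" "dead (insert m A) y"
      using leaf[OF m(3)] leaf[OF y(3)] m(3) y(2,3) by (auto simp: dead_def)
    moreover have "card T = 3" using stacked_triangle[OF Suc.prems(1)] by (simp add: triangle_in_def)
    then obtain z where z: "T = {x, y, z}" "z \<noteq> x" "z \<noteq> y"
      using card_3_third m(2) y by metis
    moreover have "stacked V E 4 (insert m A) (insert m (T - {z}))"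
      by (rule stacked_mono[OF sub]) (simp_all add: z)
    moreover have "{x, y} \<notin> F" using Suc.prems(2) m y by (auto simp: free_def)
    ultimately show False using no_two_dead[of "insert m A" "insert m (T - {z})" x y] z y by auto
  next
    case False
    let ?T = "insert m (T - {x})"
    have "free ?T" using free_subset[OF Suc.prems(2)] False by (intro free_insert) auto
    \<comment> \<open>The neighbour \<open>m\<close> outside \<open>A\<close> gives \<open>x\<close>
      weight 1 or 2. In the first case \<open>m\<close> is a leaf at \<open>x\<close> and thus dead;
      in the second \<open>m\<close> is good and weighs at most 1.\<close>
    moreover have "weight (insert m A) m < weight A x"
    proof -
      have "\<not> dead A x" using m by (auto simp: dead_def insert_commute)
      moreover have "dead (insert m A) m" if "good A x"
        using that m T unfolding good_def dead_def by (metis insert_commute insertI2 subsetD)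
      ultimately show ?thesis using m(4) by (auto simp: weight_def)
    qed
    moreover have "(\<Sum>y\<in>T - {x}. weight (insert m A) y) \<le> (\<Sum>y\<in>T - {x}. weight A y)"
      by (intro sum_mono weight_mono) auto
    moreover have "(\<Sum>y\<in>?T. weight (insert m A) y)
        = weight (insert m A) m + (\<Sum>y\<in>T - {x}. weight (insert m A) y)"
      using T m by (subst sum.insert) auto
    moreover have "(\<Sum>y\<in>T. weight A y) = weight A x + (\<Sum>y\<in>T - {x}. weight A y)"
      using T m by (simp add: sum.remove)
    ultimately show False using Suc.IH[OF sub[OF m(2)]] Suc.prems(3) by linarith
  qed
qed

text \<open>Three corners of weight at most 2 give a total of at most 6; hence 6 + 5 levels.\<close>

lemma no_free_stacked:
  assumes "stacked V E 11 A T" "free T"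
  shows False
proof (rule no_free_triangle[OF _ assms(2)])
  show "stacked V E (6 + 5) A T" using assms(1) by simp
  have "(\<Sum>x\<in>T. weight A x) \<le> (\<Sum>x\<in>T. 2)" by (intro sum_mono) (auto simp: weight_def)
  also have "\<dots> = 6" using stacked_triangle[OF assms(1)] by (auto simp: triangle_in_def)
  finally show "(\<Sum>x\<in>T. weight A x) \<le> 6" .
qed

text \<open>Two levels on top of 11 suffice to reach a free face. If \<open>T\<close> is not free,
  it has an \<open>F\<close>-edge with a leaf \<open>x\<close>; dropping its other end
  \<open>y\<close> leaves a face on \<open>v\<close>, \<open>x\<close>, \<open>z\<close> in which
  only \<open>{v, z}\<close> can lie in \<open>F\<close>. A second vertex \<open>w\<close> deals
  with that edge.\<close>

lemma no_stacked: "\<not> stacked V E 13 A T"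
proof
  assume st: "stacked V E 13 A T"
  have T: "card T = 3" "T \<subseteq> A" using stacked_triangle[OF st] by (auto simp: triangle_in_def)
  have "\<not> free T" using no_free_stacked[OF stacked_mono[OF st]] by auto
  then obtain x' y' where xy': "x' \<in> T" "y' \<in> T" "x' \<noteq> y'" "{x', y'} \<in> F"
    unfolding free_def by blast
  obtain x y where xy: "x \<in> T" "y \<in> T" "x \<noteq> y" "{x, y} \<in> F" "\<And>z. {x, z} \<in> F \<Longrightarrow> z = y"
    using leaf[OF xy'(4)]
  proof
    assume "\<forall>z. {x', z} \<in> F \<longrightarrow> z = y'"
    then show ?thesis using that[of x' y'] xy' by blast
  next
    assume "\<forall>z. {y', z} \<in> F \<longrightarrow> z = x'"
    moreover have "{y', x'} \<in> F" using xy'(4) by (simp add: insert_commute)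
    ultimately show ?thesis using that[of y' x'] xy'(1-3) by blast
  qed
  from card_3_third[OF T(1) xy(1-3)] obtain z where z: "T = {x, y, z}" "z \<noteq> x" "z \<noteq> y" .
  have "stacked V E (Suc 12) A T" using st by simp
  from stacked_SucE[OF this] obtain v where v: "v \<notin> A"
    "\<And>x. x \<in> T \<Longrightarrow> stacked V E 12 (insert v A) (insert v (T - {x}))" by metis
  have "insert v (T - {y}) = {v, x, z}" using z xy(3) by auto
  then have sv: "stacked V E (Suc 11) (insert v A) {v, x, z}" using v(2)[OF xy(2)] by simp
  have vne: "v \<noteq> x" "v \<noteq> y" "v \<noteq> z" using v(1) T z by auto
  have vz: "{v, z} \<in> F"
  proof (rule ccontr)
    assume "{v, z} \<notin> F"
    moreover have "{x, v} \<notin> F" "{x, z} \<notin> F" using xy(5) z vne by blast+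
    ultimately have "free {v, x, z}" by (intro freeI) (simp_all add: insert_commute)
    then show False using no_free_stacked[OF stacked_Suc_imp[OF sv]] by blast
  qed
  from stacked_SucE[OF sv] obtain w where w: "w \<notin> insert v A"
    "\<And>u. u \<in> {v, x, z} \<Longrightarrow> stacked V E 11 (insert w (insert v A)) (insert w ({v, x, z} - {u}))"
    by metis
  have wne: "w \<noteq> v" "w \<noteq> x" "w \<noteq> y" "w \<noteq> z" using w(1) T z by auto
  have "{v, x, z} - {z} = {v, x}" "{v, x, z} - {v} = {x, z}" using vne z by auto
  then have "stacked V E 11 (insert w (insert v A)) {w, v, x}"
    "stacked V E 11 (insert w (insert v A)) {w, x, z}" using w(2)[of z] w(2)[of v] by auto
  \<comment> \<open>One end of \<open>{v, z}\<close> is a leaf and so not joined to \<open>w\<close>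
    in \<open>F\<close>; that end, \<open>w\<close> and \<open>x\<close> form a free face.\<close>
  moreover have "free {w, v, x} \<or> free {w, x, z}"
  proof -
    have no: "{x, v} \<notin> F" "{x, z} \<notin> F" "{x, w} \<notin> F" using xy(5) z vne wne by blast+
    have "{v, w} \<notin> F \<or> {z, w} \<notin> F" using leaf[OF vz] wne by blast
    then show ?thesis
    proof
      assume "{v, w} \<notin> F"
      then have "free {w, v, x}" using no by (intro freeI) (simp_all add: insert_commute)
      then show ?thesis ..
    next
      assume "{z, w} \<notin> F"
      then have "free {w, x, z}" using no by (intro freeI) (simp_all add: insert_commute)
      then show ?thesis ..
    qed
  qed
  ultimately show False using no_free_stacked by blast
qed

end

lemma stacked_star_forest_K4:
  assumes "simple_graph V E" "stacked V E 13 A T" "star_forest V E F"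
  shows "contains_K4 V (E - F)"
proof (rule ccontr)
  assume "\<not> contains_K4 V (E - F)"
  then interpret leaf_forest V E F
    using star_forest_leaf[OF assms(1,3)] by unfold_locales
  show False using no_stacked assms(2) by blast
qed

text \<open>The drawing gives a graph on points of the plane, while the vertices sought are natural
  numbers. An injective renaming preserves stackings, as these are expressed through membership and
  cardinality.\<close>

lemma stacked_pullback:
  assumes inj: "inj_on p V"
    and "stacked (p ` V) E n (p ` A) (p ` T)" "A \<subseteq> V" "T \<subseteq> V"
  shows "stacked V {e. e \<subseteq> V \<and> p ` e \<in> E} n A T"
  using assms(2-)
proof (induction n arbitrary: A T)
  case (0 A T)
  then have "T \<subseteq> A" "triangle_in (p ` V) E (p ` T)"
    using inj by (auto simp: stacked.simps inj_on_image_subset_iff)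
  then show ?case using 0(3) inj inj_on_subset[OF inj 0(3)]
    by (auto simp: stacked.simps triangle_in_def card_image inj_on_eq_iff subset_iff)
next
  case (Suc n A T)
  have base: "stacked V {e. e \<subseteq> V \<and> p ` e \<in> E} n A T"
    using Suc.IH Suc.prems stacked_Suc_imp by blast
  obtain m where m: "m \<in> V" "p m \<notin> p ` A"
    "\<And>x. x \<in> T \<Longrightarrow> stacked (p ` V) E n (insert (p m) (p ` A)) (insert (p m) (p ` T - {p x}))"
    using Suc.prems(1) unfolding stacked.simps by auto
  have "stacked V {e. e \<subseteq> V \<and> p ` e \<in> E} n (insert m A) (insert m (T - {x}))" if "x \<in> T" for x
  proof (rule Suc.IH)
    have "p ` T - {p x} = p ` (T - {x})"
      using inj_on_image_set_diff[OF inj, of T "{x}"] Suc.prems(3) that by auto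
    then show "stacked (p ` V) E n (p ` insert m A) (p ` insert m (T - {x}))"
      using m(3)[OF that] by simp
  qed (use m Suc.prems in auto)
  then show ?case using m stacked_triangle[OF base] unfolding stacked.simps by blast
qed

section \<open>Straight-line drawings\<close>

text \<open>The relative interior treats vertices and edges alike: a point is its own cell, an edge
  has its open segment. Planarity of a drawing becomes disjointness of cells.\<close>

definition cell :: "complex set \<Rightarrow> complex set" where
  "cell s = rel_interior (convex hull s)"

lemma cell_singleton [simp]: "cell {v} = {v}"
  by (simp add: cell_def)

lemma cell_doubleton: "u \<noteq> v \<Longrightarrow> cell {u, v} = open_segment u v"
  by (simp add: cell_def flip: segment_convex_hull add: rel_interior_closed_segment)

text \<open>A closed segment is its cell plus its two ends, so disjoint cells keep the interior of
  an edge away from all vertices and from the other edges. Two edges then meet in vertices only, and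
  these are common ends.\<close>

lemma planar_graph_of_cells:
  fixes K :: "complex set set" and pos :: "nat \<Rightarrow> complex"
  assumes fin: "finite V" and bij: "bij_betw pos V {v. {v} \<in> K}"
    and K: "\<And>s v. s \<in> K \<Longrightarrow> v \<in> s \<Longrightarrow> {v} \<in> K"
    and disj: "\<And>s t p. s \<in> K \<Longrightarrow> t \<in> K \<Longrightarrow> p \<in> cell s \<Longrightarrow> p \<in> cell t \<Longrightarrow> s = t"
  shows "planar_graph V {e. e \<subseteq> V \<and> pos ` e \<in> {s \<in> K. card s = 2}}" (is "planar_graph V ?E")
proof -
  have inj: "inj_on pos V" and im: "pos ` V = {v. {v} \<in> K}"
    using bij by (auto simp: bij_betw_def)
  \<comment> \<open>Edges are unordered; the smaller end is taken as the start of the arc.\<close>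
  define l where "l e = pos (Min e)" for e :: "nat set"
  define r where "r e = pos (Max e)" for e :: "nat set"
  have E: "\<exists>u v. u \<in> V \<and> v \<in> V \<and> u \<noteq> v \<and> e = {u, v} \<and> l e = pos u \<and> r e = pos v" if "e \<in> ?E" for e
  proof -
    have "card e = 2" using that inj_on_subset[OF inj, of e] card_image by fastforce
    then obtain x y where xy: "e = {x, y}" "x \<noteq> y" by (auto simp: card_2_iff)
    show ?thesis
    proof (cases "x < y")
      case True
      then show ?thesis using xy that by (intro exI[of _ x] exI[of _ y]) (auto simp: l_def r_def)
    next
      case False
      then show ?thesis using xy that by (intro exI[of _ y] exI[of _ x]) (auto simp: l_def r_def)
    qed
  qed
  have ne: "l e \<noteq> r e" and ends: "pos ` e = {l e, r e}" if "e \<in> ?E" for e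
    using E[OF that] inj by (auto simp: inj_on_eq_iff)
  have seg: "closed_segment (l e) (r e) = cell (pos ` e) \<union> pos ` e" if "e \<in> ?E" for e
    using ne[OF that] ends[OF that] by (simp add: cell_doubleton closed_segment_eq_open)
  have arc_V: "closed_segment (l e) (r e) \<inter> pos ` V = pos ` e" if e: "e \<in> ?E" for e
  proof -
    have "p \<notin> pos ` V" if "p \<in> cell (pos ` e)" for p
    proof
      assume "p \<in> pos ` V"
      then have "{p} = pos ` e" using disj[of "{p}" "pos ` e" p] that e im by auto
      moreover have "card (pos ` e) = 2" using e by simp
      ultimately show False by (metis card_1_singleton_iff One_nat_def n_not_Suc_n numeral_2_eq_2)
    qed
    then show ?thesis using seg[OF e] e by auto
  qed
  have arc_arc: "closed_segment (l e) (r e) \<inter> closed_segment (l e') (r e') \<subseteq> pos ` (e \<inter> e')"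
    if e: "e \<in> ?E" and e': "e' \<in> ?E" and "e \<noteq> e'" for e e'
  proof
    fix p assume p: "p \<in> closed_segment (l e) (r e) \<inter> closed_segment (l e') (r e')"
    have "pos ` e \<noteq> pos ` e'"
      using that inj by (auto simp: inj_on_image_eq_iff)
    then have "\<not> (p \<in> cell (pos ` e) \<and> p \<in> cell (pos ` e'))"
      using disj[of "pos ` e" "pos ` e'" p] e e' by auto
    then have "p \<in> pos ` V" using p seg[OF e] seg[OF e'] e e' by auto
    then have "p \<in> pos ` e \<inter> pos ` e'" using p arc_V[OF e] arc_V[OF e'] by auto
    moreover have "pos ` (e \<inter> e') = pos ` e \<inter> pos ` e'"
      using inj e e' by (intro inj_on_image_Int[of pos V]) auto
    ultimately show "p \<in> pos ` (e \<inter> e')" by simp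
  qed
  have "simple_graph V ?E" unfolding simple_graph_def using fin E by blast
  moreover have "\<exists>u v. e = {u, v} \<and> l e = pos u \<and> r e = pos v" if "e \<in> ?E" for e
    using E[OF that] by blast
  ultimately show ?thesis
    unfolding planar_graph_def using inj ne arc_V arc_arc
    by (intro conjI exI[of _ pos] exI[of _ "\<lambda>e. linepath (l e) (r e)"] ballI impI) simp_all
qed

text \<open>Twice the signed area of the triangle with corners a, b, p.\<close>
definition orient :: "complex \<Rightarrow> complex \<Rightarrow> complex \<Rightarrow> real" where
  "orient a b p = (Re b - Re a) * (Im p - Im a) - (Im b - Im a) * (Re p - Re a)"

text \<open>For corners in counterclockwise order this is the interior; otherwise it is
  empty.\<close>

definition open_triangle :: "complex \<Rightarrow> complex \<Rightarrow> complex \<Rightarrow> complex set" where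
  "open_triangle a b c = {p. 0 < orient a b p \<and> 0 < orient b c p \<and> 0 < orient c a p}"

definition centroid :: "complex \<Rightarrow> complex \<Rightarrow> complex \<Rightarrow> complex" where
  "centroid a b c = (a + b + c) / 3"

lemma Re_centroid: "Re (centroid a b c) = (Re a + Re b + Re c) / 3"
  and Im_centroid: "Im (centroid a b c) = (Im a + Im b + Im c) / 3"
  by (simp_all add: centroid_def)

lemma orient_self [simp]: "orient a a p = 0" "orient a b a = 0" "orient a b b = 0"
  by (simp_all add: orient_def algebra_simps)

lemma orient_rotate: "orient b c a = orient a b c" "orient c a b = orient a b c"
  by (simp_all add: orient_def algebra_simps)

lemma orient_centroid:
  "orient a b (centroid a b c) = orient a b c / 3"
  "orient b c (centroid a b c) = orient a b c / 3"
  "orient c a (centroid a b c) = orient a b c / 3"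
  by (simp_all add: orient_def Re_centroid Im_centroid algebra_simps; simp add: field_simps)+

text \<open>The vector from a corner to the centroid is a third of the sum of the two sides leaving
  that corner, and \<open>orient\<close> is linear in it; reversing a vector changes the
  sign.\<close>

lemma orient_to_centroid:
  "orient a (centroid a b c) p = (orient a b p - orient c a p) / 3"
  "orient b (centroid a b c) p = (orient b c p - orient a b p) / 3"
  "orient c (centroid a b c) p = (orient c a p - orient b c p) / 3"
  "orient (centroid a b c) a p = (orient c a p - orient a b p) / 3"
  "orient (centroid a b c) b p = (orient a b p - orient b c p) / 3"
  "orient (centroid a b c) c p = (orient b c p - orient c a p) / 3"
  by (simp_all add: orient_def Re_centroid Im_centroid; simp add: field_simps)+

lemma orient_affine:
  "orient a b ((1 - t) *\<^sub>R u + t *\<^sub>R v) = (1 - t) * orient a b u + t * orient a b v"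
  by (simp add: orient_def algebra_simps)

lemma orient_distinct: "orient a b c \<noteq> 0 \<Longrightarrow> a \<noteq> b \<and> b \<noteq> c \<and> a \<noteq> c"
  by (auto simp: orient_rotate)

text \<open>In terms of the unnormalised barycentric coordinates orient b c p, orient c a p and
  orient a b p, the three parts of a stacked triangle are distinguished by which coordinate is
  smallest.\<close>
lemma open_triangle_centroid:
  "p \<in> open_triangle a b (centroid a b c) \<longleftrightarrow>
     0 < orient a b p \<and> orient a b p < orient b c p \<and> orient a b p < orient c a p"
  "p \<in> open_triangle b c (centroid a b c) \<longleftrightarrow>
     0 < orient b c p \<and> orient b c p < orient a b p \<and> orient b c p < orient c a p"
  "p \<in> open_triangle c a (centroid a b c) \<longleftrightarrow>
     0 < orient c a p \<and> orient c a p < orient a b p \<and> orient c a p < orient b c p"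
  by (auto simp: open_triangle_def orient_to_centroid)

lemma cell_orientE:
  assumes "p \<in> cell {u, v}" "u \<noteq> v"
  obtains t where "0 < t" "t < 1" "\<And>a b. orient a b p = (1 - t) * orient a b u + t * orient a b v"
  using assms by (auto simp: cell_doubleton in_segment orient_affine)

text \<open>The three coordinates are affine in \<open>p\<close>. At a corner two of them vanish and
  the third is \<open>orient a b c\<close>; at the centroid each is a third of this. Strictly in
  between, two agree and lie below the third.\<close>

lemma cell_corner_centroid:
  assumes "orient a b c > 0"
  shows "p \<in> cell {a, centroid a b c} \<Longrightarrow>
      0 < orient a b p \<and> orient c a p = orient a b p \<and> orient a b p < orient b c p"
    and "p \<in> cell {b, centroid a b c} \<Longrightarrow>
      0 < orient a b p \<and> orient b c p = orient a b p \<and> orient a b p < orient c a p"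
    and "p \<in> cell {c, centroid a b c} \<Longrightarrow>
      0 < orient b c p \<and> orient c a p = orient b c p \<and> orient b c p < orient a b p"
proof -
  have ne: "a \<noteq> centroid a b c" "b \<noteq> centroid a b c" "c \<noteq> centroid a b c"
    using assms orient_centroid[of a b c] by auto
  have rot: "orient b c a = orient a b c" "orient c a b = orient a b c"
    by (fact orient_rotate)+
  show "0 < orient a b p \<and> orient c a p = orient a b p \<and> orient a b p < orient b c p"
    if "p \<in> cell {a, centroid a b c}"
  proof -
    from cell_orientE[OF that ne(1)] obtain t where "0 < t" "t < 1"
      "\<And>x y. orient x y p = (1 - t) * orient x y a + t * orient x y (centroid a b c)" by blast
    then show ?thesis using assms by (simp add: orient_centroid rot)
  qed
  show "0 < orient a b p \<and> orient b c p = orient a b p \<and> orient a b p < orient c a p"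
    if "p \<in> cell {b, centroid a b c}"
  proof -
    from cell_orientE[OF that ne(2)] obtain t where "0 < t" "t < 1"
      "\<And>x y. orient x y p = (1 - t) * orient x y b + t * orient x y (centroid a b c)" by blast
    then show ?thesis using assms by (simp add: orient_centroid rot)
  qed
  show "0 < orient b c p \<and> orient c a p = orient b c p \<and> orient b c p < orient a b p"
    if "p \<in> cell {c, centroid a b c}"
  proof -
    from cell_orientE[OF that ne(3)] obtain t where "0 < t" "t < 1"
      "\<And>x y. orient x y p = (1 - t) * orient x y c + t * orient x y (centroid a b c)" by blast
    then show ?thesis using assms by (simp add: orient_centroid rot)
  qed
qed

section \<open>Iterated subdivision at centroids\<close>

text \<open>Only new vertices and edges are collected. Without the outer corners and sides, all
  cells of a counterclockwise triangle lie in its interior, so cells from different parts cannot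
  meet.\<close>

fun subdivision :: "nat \<Rightarrow> complex \<Rightarrow> complex \<Rightarrow> complex \<Rightarrow> complex set set" where
  "subdivision 0 a b c = {}"
| "subdivision (Suc n) a b c = (let m = centroid a b c in
     {{m}, {a, m}, {b, m}, {c, m}} \<union> subdivision n a b m \<union> subdivision n b c m \<union> subdivision n c a m)"

lemma finite_subdivision: "finite (subdivision n a b c)"
  by (induction n arbitrary: a b c) (auto simp: Let_def)

lemma subdivision_vertices: "s \<in> subdivision n a b c \<Longrightarrow> v \<in> s \<Longrightarrow> v \<in> {a, b, c} \<or> {v} \<in> subdivision n a b c"
proof (induction n arbitrary: a b c)
  case (Suc n)
  then show ?case by (simp add: Let_def) (metis insertE singletonD)
qed auto

lemma orient_sub:
  assumes "orient a b c > 0"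
  shows "orient a b (centroid a b c) > 0" "orient b c (centroid a b c) > 0"
    "orient c a (centroid a b c) > 0"
  using assms by (simp_all add: orient_centroid)

lemma subdivision_cell_subset:
  assumes "orient a b c > 0" "s \<in> subdivision n a b c"
  shows "cell s \<subseteq> open_triangle a b c"
  using assms
proof (induction n arbitrary: a b c)
  case (Suc n)
  let ?m = "centroid a b c"
  note pos = orient_sub[OF Suc.prems(1)]
  show ?case
  proof
    fix p assume p: "p \<in> cell s"
    consider "s = {?m}" | "s = {a, ?m}" | "s = {b, ?m}" | "s = {c, ?m}"
      | "s \<in> subdivision n a b ?m" | "s \<in> subdivision n b c ?m" | "s \<in> subdivision n c a ?m"
      using Suc.prems(2) by (auto simp: Let_def)
    then show "p \<in> open_triangle a b c"
    proof cases
      case 1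
      then show ?thesis using p pos by (simp add: open_triangle_def)
    next
      case 2
      then show ?thesis using p cell_corner_centroid(1)[OF Suc.prems(1)] by (force simp: open_triangle_def)
    next
      case 3
      then show ?thesis using p cell_corner_centroid(2)[OF Suc.prems(1)] by (force simp: open_triangle_def)
    next
      case 4
      then show ?thesis using p cell_corner_centroid(3)[OF Suc.prems(1)] by (force simp: open_triangle_def)
    next
      case 5
      then have "p \<in> open_triangle a b ?m" using p Suc.IH[OF pos(1)] by blast
      then show ?thesis unfolding open_triangle_centroid by (simp add: open_triangle_def)
    next
      case 6
      then have "p \<in> open_triangle b c ?m" using p Suc.IH[OF pos(2)] by blast
      then show ?thesis unfolding open_triangle_centroid by (simp add: open_triangle_def)
    next
      case 7
      then have "p \<in> open_triangle c a ?m" using p Suc.IH[OF pos(3)] by blast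
      then show ?thesis unfolding open_triangle_centroid by (simp add: open_triangle_def)
    qed
  qed
qed simp

text \<open>A point determines which of its three coordinates are smallest. The seven nonempty sets
  of coordinates match the centroid, the three new edges and the three parts, so \<open>s\<close>
  and \<open>t\<close> are equal or come from the same part.\<close>

lemma subdivision_cells_disjoint:
  assumes "orient a b c > 0" "s \<in> subdivision n a b c" "t \<in> subdivision n a b c" "p \<in> cell s" "p \<in> cell t"
  shows "s = t"
  using assms
proof (induction n arbitrary: a b c)
  case (Suc n)
  let ?m = "centroid a b c"
  let ?x = "orient b c p" and ?y = "orient c a p" and ?z = "orient a b p"
  note pos = orient_sub[OF Suc.prems(1)]
  note corner = cell_corner_centroid[OF Suc.prems(1)]
  have loc: "u = {?m} \<and> ?x = ?y \<and> ?y = ?z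
      \<or> u = {a, ?m} \<and> ?y = ?z \<and> ?z < ?x \<or> u = {b, ?m} \<and> ?x = ?z \<and> ?z < ?y
      \<or> u = {c, ?m} \<and> ?x = ?y \<and> ?y < ?z
      \<or> u \<in> subdivision n a b ?m \<and> ?z < ?x \<and> ?z < ?y
      \<or> u \<in> subdivision n b c ?m \<and> ?x < ?y \<and> ?x < ?z
      \<or> u \<in> subdivision n c a ?m \<and> ?y < ?x \<and> ?y < ?z"
    if u: "u \<in> subdivision (Suc n) a b c" and p: "p \<in> cell u" for u
  proof -
    have "?x = ?y \<and> ?y = ?z" if "u = {?m}" using that p by (simp add: orient_centroid)
    moreover have "?y = ?z \<and> ?z < ?x" if "u = {a, ?m}" using that p corner(1) by blast
    moreover have "?x = ?z \<and> ?z < ?y" if "u = {b, ?m}" using that p corner(2) by blast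
    moreover have "?x = ?y \<and> ?y < ?z" if "u = {c, ?m}" using that p corner(3)[of p] by simp
    moreover have "?z < ?x \<and> ?z < ?y" if "u \<in> subdivision n a b ?m"
      using subdivision_cell_subset[OF pos(1) that] p open_triangle_centroid(1) by blast
    moreover have "?x < ?y \<and> ?x < ?z" if "u \<in> subdivision n b c ?m"
      using subdivision_cell_subset[OF pos(2) that] p open_triangle_centroid(2) by blast
    moreover have "?y < ?x \<and> ?y < ?z" if "u \<in> subdivision n c a ?m"
      using subdivision_cell_subset[OF pos(3) that] p open_triangle_centroid(3) by blast
    moreover have "u = {?m} \<or> u = {a, ?m} \<or> u = {b, ?m} \<or> u = {c, ?m}
      \<or> u \<in> subdivision n a b ?m \<or> u \<in> subdivision n b c ?m \<or> u \<in> subdivision n c a ?m"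
      using u by (auto simp: Let_def)
    ultimately show ?thesis by argo
  qed
  have "s = t \<or> s \<in> subdivision n a b ?m \<and> t \<in> subdivision n a b ?m
      \<or> s \<in> subdivision n b c ?m \<and> t \<in> subdivision n b c ?m \<or> s \<in> subdivision n c a ?m \<and> t \<in> subdivision n c a ?m"
    using loc[OF Suc.prems(2,4)] loc[OF Suc.prems(3,5)] by (elim disjE conjE) simp_all
  then show ?case using Suc.IH pos Suc.prems(4,5) by blast
qed simp

text \<open>That \<open>A\<close> misses the open triangle makes the centroid a new vertex.\<close>

lemma stacked_subdivision:
  assumes "orient a b c > 0" "{a, b, c} \<subseteq> A" "A \<subseteq> V" "A \<inter> open_triangle a b c = {}"
    and "{{a, b}, {b, c}, {c, a}} \<subseteq> E"
    and "\<And>v. {v} \<in> subdivision n a b c \<Longrightarrow> v \<in> V"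
    and "\<And>e. e \<in> subdivision n a b c \<Longrightarrow> card e = 2 \<Longrightarrow> e \<in> E"
  shows "stacked V E n A {a, b, c}"
  using assms
proof (induction n arbitrary: a b c A)
  case (0 a b c A)
  moreover have "{a, b, c} \<subseteq> V" using 0(2,3) by blast
  ultimately show ?case using orient_distinct[of a b c] triangle_inI[of a b c V E]
    by (simp add: stacked.simps)
next
  case (Suc n a b c A)
  let ?m = "centroid a b c"
  note pos = orient_sub[OF Suc.prems(1)]
  have ne: "a \<noteq> b" "b \<noteq> c" "a \<noteq> c" using orient_distinct[of a b c] Suc.prems(1) by auto
  have mne: "a \<noteq> ?m" "b \<noteq> ?m" "c \<noteq> ?m" using pos by auto
  have m: "?m \<in> open_triangle a b c" using pos by (simp add: open_triangle_def)
  then have mV: "?m \<in> V" "?m \<notin> A" using Suc.prems(4,6) by (auto simp: Let_def)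
  have edges: "{a, ?m} \<in> E" "{b, ?m} \<in> E" "{c, ?m} \<in> E"
    using Suc.prems(7) mne by (auto simp: Let_def)
  \<comment> \<open>The open parts omit the centroid, so \<open>insert ?m A\<close> misses them and
    the invariant passes on.\<close>
  have sub: "open_triangle a b ?m \<subseteq> open_triangle a b c - {?m}"
    "open_triangle b c ?m \<subseteq> open_triangle a b c - {?m}"
    "open_triangle c a ?m \<subseteq> open_triangle a b c - {?m}"
    using pos by (auto simp: open_triangle_centroid orient_centroid)
      (auto simp: open_triangle_def)
  have 1: "stacked V E n (insert ?m A) {a, b, ?m}"
    using Suc.prems mV sub(1) edges by (intro Suc.IH[OF pos(1)]) (auto simp: Let_def insert_commute)
  have 2: "stacked V E n (insert ?m A) {b, c, ?m}"
    using Suc.prems mV sub(2) edges by (intro Suc.IH[OF pos(2)]) (auto simp: Let_def insert_commute)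
  have 3: "stacked V E n (insert ?m A) {c, a, ?m}"
    using Suc.prems mV sub(3) edges by (intro Suc.IH[OF pos(3)]) (auto simp: Let_def insert_commute)
  have "{a, b, c} - {a} = {b, c}" "{a, b, c} - {b} = {c, a}" "{a, b, c} - {c} = {a, b}"
    using ne by auto
  then have "\<forall>x\<in>{a, b, c}. stacked V E n (insert ?m A) (insert ?m ({a, b, c} - {x}))"
    using 1 2 3 by (simp add: insert_commute)
  moreover have "triangle_in V E {a, b, c}"
    using Suc.prems(2,3,5) by (intro triangle_inI[OF ne]) auto
  ultimately show ?case using Suc.prems(2) mV unfolding stacked.simps by blast
qed

section \<open>The graph and its plane drawing\<close>

theorem theorem7:
  shows "\<exists>(V :: nat set) E. planar_graph V E \<and>
           (\<forall>F. star_forest V E F \<longrightarrow> contains_K4 V (E - F))"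
proof -
  define a b c :: complex where "a = 0" and "b = 1" and "c = \<i>"
  have pos: "orient a b c > 0" by (simp add: orient_def a_def b_def c_def)
  have ne: "a \<noteq> b" "b \<noteq> c" "c \<noteq> a" using orient_distinct[of a b c] pos by auto
  \<comment> \<open>The outer corners and sides, left out by \<open>subdivision\<close>, are added.
    The depth 13 is the one in \<open>no_stacked\<close>.\<close>
  define K where "K = {{a}, {b}, {c}, {a, b}, {b, c}, {c, a}} \<union> subdivision 13 a b c"
  define W where "W = {v. {v} \<in> K}"
  define D where "D = {s \<in> K. card s = 2}"
  have vert: "{v} \<in> K" if "s \<in> K" "v \<in> s" for s v
    using that subdivision_vertices[of s 13 a b c v] by (auto simp: K_def)
  have disj: "s = t" if "s \<in> K" "t \<in> K" "p \<in> cell s" "p \<in> cell t" for s t p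
  proof -
    let ?x = "orient b c p" and ?y = "orient c a p" and ?z = "orient a b p"
    have rot: "orient b c a = orient a b c" "orient c a b = orient a b c"
      by (fact orient_rotate)+
    \<comment> \<open>The vanishing coordinates tell the cells apart: two at an outer corner, one on
      an outer side, none inside.\<close>
    have loc: "u = {a} \<and> 0 < ?x \<and> ?y = 0 \<and> ?z = 0 \<or> u = {b} \<and> ?x = 0 \<and> 0 < ?y \<and> ?z = 0
      \<or> u = {c} \<and> ?x = 0 \<and> ?y = 0 \<and> 0 < ?z
      \<or> u = {a, b} \<and> 0 < ?x \<and> 0 < ?y \<and> ?z = 0 \<or> u = {b, c} \<and> ?x = 0 \<and> 0 < ?y \<and> 0 < ?z
      \<or> u = {c, a} \<and> 0 < ?x \<and> ?y = 0 \<and> 0 < ?z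
      \<or> u \<in> subdivision 13 a b c \<and> 0 < ?x \<and> 0 < ?y \<and> 0 < ?z" if u: "u \<in> K" and p: "p \<in> cell u" for u
    proof -
      have "0 < ?x \<and> ?y = 0 \<and> ?z = 0" if "u = {a}" using that p pos by (simp add: rot)
      moreover have "?x = 0 \<and> 0 < ?y \<and> ?z = 0" if "u = {b}" using that p pos by (simp add: rot)
      moreover have "?x = 0 \<and> ?y = 0 \<and> 0 < ?z" if "u = {c}" using that p pos by (simp add: rot)
      moreover have "0 < ?x \<and> 0 < ?y \<and> ?z = 0" if "u = {a, b}"
      proof -
        from that p ne obtain t where "0 < t" "t < 1"
          "\<And>x y. orient x y p = (1 - t) * orient x y a + t * orient x y b"
          using cell_orientE[of p a b] by blast
        then show ?thesis using pos by (simp add: rot)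
      qed
      moreover have "?x = 0 \<and> 0 < ?y \<and> 0 < ?z" if "u = {b, c}"
      proof -
        from that p ne obtain t where "0 < t" "t < 1"
          "\<And>x y. orient x y p = (1 - t) * orient x y b + t * orient x y c"
          using cell_orientE[of p b c] by blast
        then show ?thesis using pos by (simp add: rot)
      qed
      moreover have "0 < ?x \<and> ?y = 0 \<and> 0 < ?z" if "u = {c, a}"
      proof -
        from that p ne obtain t where "0 < t" "t < 1"
          "\<And>x y. orient x y p = (1 - t) * orient x y c + t * orient x y a"
          using cell_orientE[of p c a] by blast
        then show ?thesis using pos by (simp add: rot)
      qed
      moreover have "0 < ?x \<and> 0 < ?y \<and> 0 < ?z" if "u \<in> subdivision 13 a b c"
        using subdivision_cell_subset[OF pos that] p by (auto simp: open_triangle_def)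
      moreover have "u = {a} \<or> u = {b} \<or> u = {c} \<or> u = {a, b} \<or> u = {b, c} \<or> u = {c, a}
        \<or> u \<in> subdivision 13 a b c" using u by (auto simp: K_def)
      ultimately show ?thesis by argo
    qed
    have "s = t \<or> s \<in> subdivision 13 a b c \<and> t \<in> subdivision 13 a b c"
      using loc[OF that(1,3)] loc[OF that(2,4)] by (elim disjE conjE) simp_all
    then show ?thesis using subdivision_cells_disjoint[OF pos] that by blast
  qed
  have "finite W"
  proof (rule finite_imageD[of "\<lambda>v. {v}"])
    show "finite ((\<lambda>v. {v}) ` W)"
      by (rule finite_subset[of _ K]) (auto simp: W_def K_def finite_subdivision)
  qed auto
  \<comment> \<open>Numbering the finitely many points turns them into vertices of type
    \<open>nat\<close>.\<close>
  then obtain p where p: "bij_betw p {0..<card W} W" using ex_bij_betw_nat_finite by blast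
  let ?V = "{0..<card W}" and ?E = "{e. e \<subseteq> {0..<card W} \<and> p ` e \<in> D}"
  have planar: "planar_graph ?V ?E"
    using planar_graph_of_cells[of ?V p K] p vert disj unfolding W_def D_def by blast
  have abc: "{a, b, c} \<subseteq> W" by (auto simp: W_def K_def)
  have "stacked W D 13 {a, b, c} {a, b, c}"
  proof (rule stacked_subdivision[OF pos])
    show "{a, b, c} \<inter> open_triangle a b c = {}" by (auto simp: open_triangle_def)
    show "{{a, b}, {b, c}, {c, a}} \<subseteq> D" using ne by (auto simp: D_def K_def)
  qed (use abc in \<open>auto simp: W_def D_def K_def\<close>)
  \<comment> \<open>\<open>T\<close> holds the numbers of the outer corners. Only these are present
    at the start, so \<open>T\<close> also serves as \<open>A\<close>.\<close>
  moreover obtain T where T: "T \<subseteq> ?V" "p ` T = {a, b, c}"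
    using abc p unfolding bij_betw_def by (metis subset_image_iff)
  ultimately have "stacked ?V ?E 13 T T"
    using stacked_pullback[of p ?V D 13 T T] p by (simp add: bij_betw_def)
  moreover have "simple_graph ?V ?E" using planar by (simp add: planar_graph_def)
  ultimately have "\<forall>F. star_forest ?V ?E F \<longrightarrow> contains_K4 ?V (?E - F)"
    using stacked_star_forest_K4[of ?V ?E T T] by blast
  then show ?thesis using planar by blast
qed

end
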